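(* Let $\delta\in(0,\pi)$ and $\omega\in(0,1/2)$ be fixed, and let $\lambda_\delta(n)=\frac{4}{\delta^2}\left(1-e^{-(n\delta)^2/4}\right)$ for $n\in\mathbb{Z}^+$. For $\gamma>0$ let $N^*(\gamma)$ be the largest minimizer over $N\in\mathbb{Z}^+$ of $$2N+\frac{2\gamma}{\pi}\sum_{m=1}^{\infty}\frac{1}{\lambda_\delta(mN)}\left(\frac{\sin(m\pi\omega)}{m}\right)^2 .$$ Then $N^*(\gamma)$, as a function of $\gamma\in(0,\infty)$, is monotonically increasing (i.e. nondecreasing) with no upper bound.
   Context: The numbers $\lambda_\delta(n)$ are the eigenvalues used for the one-dimensional nonlocal operator with Gauss-type kernel (a constant multiple of $\delta^{-3}e^{-|s|^2/\delta^2}$). *)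

theory Defs
  imports Complex_Main
begin

definition gauss_eigenvalue :: "real \<Rightarrow> nat \<Rightarrow> real" where
  "gauss_eigenvalue \<delta> n = 4 / \<delta>\<^sup>2 * (1 - exp (- ((real n * \<delta>)\<^sup>2 / 4)))"

definition energy_term :: "real \<Rightarrow> real \<Rightarrow> nat \<Rightarrow> nat \<Rightarrow> real" where
  "energy_term \<delta> \<omega> N m =
     1 / gauss_eigenvalue \<delta> (m * N) * (sin (real m * pi * \<omega>) / real m)\<^sup>2"

text \<open>The series runs over \<open>m = Suc k\<close>, i.e. \<open>m \<ge> 1\<close>.\<close>

definition energy :: "real \<Rightarrow> real \<Rightarrow> real \<Rightarrow> nat \<Rightarrow> real" where
  "energy \<delta> \<omega> \<gamma> N =
     2 * real N + 2 * \<gamma> / pi * (\<Sum>k. energy_term \<delta> \<omega> N (Suc k))"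

definition is_energy_minimizer :: "real \<Rightarrow> real \<Rightarrow> real \<Rightarrow> nat \<Rightarrow> bool" where
  "is_energy_minimizer \<delta> \<omega> \<gamma> N \<longleftrightarrow> is_arg_min (energy \<delta> \<omega> \<gamma>) (\<lambda>N. N \<ge> 1) N"

text \<open>The value is meaningful only if a largest minimizer exists, since \<open>Greatest\<close> is
  otherwise unspecified.\<close>

definition N_star :: "real \<Rightarrow> real \<Rightarrow> real \<Rightarrow> nat" where
  "N_star \<delta> \<omega> \<gamma> = (GREATEST N. is_energy_minimizer \<delta> \<omega> \<gamma> N)"

end

theory Submission
  imports Defs "HOL-Analysis.Summation_Tests"
begin

text \<open>
  As a function of \<open>N\<close>, the energy is \<open>2 * N + \<gamma> * S N\<close>, where the penalty \<open>S\<close> does not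
  depend on \<open>\<gamma>\<close>. Everything follows from this shape together with two properties of \<open>S\<close>: it is
  nonnegative, and it is strictly decreasing on the positive integers.

  Nonnegativity of \<open>S\<close> makes the energy coercive, so it has a minimizer, and only finitely many of
  them (\<open>penalized_Greatest_minimizer\<close>). A comparison of two minimizers for two weights
  shows that raising the weight cannot lower the largest minimizer
  (\<open>penalized_minimizer_mono\<close>). Finally, if the minimizers stayed below some \<open>B\<close>, then passing from
  \<open>N \<le> B\<close> to \<open>B + 1\<close> would cost a bounded amount in the linear part but save at least
  \<open>\<gamma> * (S B - S (B + 1))\<close>, which exceeds any bound for large \<open>\<gamma>\<close>
  (\<open>penalized_minimizer_exceeds\<close>).

  The strict decrease of \<open>S\<close> is inherited from the summands: \<open>gauss_eigenvalue\<close> is strictly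
  increasing, so each summand is nonincreasing in \<open>N\<close>, and the one for \<open>m = 1\<close> strictly decreases
  because \<open>sin (pi * \<omega>) \<noteq> 0\<close>.
\<close>

text \<open>The linear part is at most the whole value, and that of a minimizer is at most the value at
  \<open>1\<close>; so all minimizers are found in a finite set.\<close>

lemma penalized_Greatest_minimizer:
  fixes S :: "nat \<Rightarrow> real" and \<gamma> :: real
  defines "M \<equiv> is_arg_min (\<lambda>N. 2 * real N + \<gamma> * S N) (\<lambda>N. N \<ge> 1)"
  assumes nonneg: "\<And>N. N \<ge> 1 \<Longrightarrow> 0 \<le> S N" and "\<gamma> > 0"
  shows "M (GREATEST N. M N)" and "M N \<Longrightarrow> N \<le> (GREATEST N. M N)"
proof -
  define F where "F = (\<lambda>N. 2 * real N + \<gamma> * S N)"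
  define A where "A = {N. 1 \<le> N \<and> F N \<le> F 1}"
  have bound: "N \<le> nat \<lceil>F 1\<rceil>" if "N \<in> A" for N
  proof -
    have "0 \<le> \<gamma> * S N"
      using that nonneg \<open>\<gamma> > 0\<close> by (simp add: A_def)
    then have "real N \<le> F 1"
      using that unfolding A_def F_def by simp
    then show ?thesis
      by linarith
  qed
  have "finite A"
    using bound by (meson finite_nat_set_iff_bounded_le)
  moreover have "1 \<in> A"
    by (simp add: A_def)
  ultimately obtain K where K: "K \<in> A" "\<And>N. N \<in> A \<Longrightarrow> F K \<le> F N"
    using arg_min_if_finite[of A F] arg_min_least[of A _ F] by (metis empty_iff)
  have "M K"
    unfolding M_def F_def[symmetric] is_arg_min_linorder
    using K \<open>1 \<in> A\<close> unfolding A_def by (smt (verit) mem_Collect_eq)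
  have le: "N \<le> nat \<lceil>F 1\<rceil>" if "M N" for N
  proof (rule bound)
    show "N \<in> A"
      using that unfolding A_def M_def F_def[symmetric] is_arg_min_linorder by simp
  qed
  show "M (GREATEST N. M N)"
    using \<open>M K\<close> le by (rule GreatestI_nat)
  show "N \<le> (GREATEST N. M N)" if "M N"
    using that le by (rule Greatest_le_nat)
qed

text \<open>Suppose \<open>N\<^sub>2 < N\<^sub>1\<close>. Since \<open>N\<^sub>1\<close> is optimal for the weight \<open>\<gamma>\<^sub>1\<close> in spite of its larger linear
  part, its penalty is strictly smaller; this advantage only grows with the weight, so \<open>N\<^sub>1\<close> would
  beat \<open>N\<^sub>2\<close> for \<open>\<gamma>\<^sub>2\<close> as well.\<close>

lemma penalized_minimizer_mono:
  fixes S :: "nat \<Rightarrow> real"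
  assumes "is_arg_min (\<lambda>N. 2 * real N + \<gamma>\<^sub>1 * S N) (\<lambda>N. N \<ge> 1) N\<^sub>1"
    and "is_arg_min (\<lambda>N. 2 * real N + \<gamma>\<^sub>2 * S N) (\<lambda>N. N \<ge> 1) N\<^sub>2"
    and "0 < \<gamma>\<^sub>1" and "\<gamma>\<^sub>1 < \<gamma>\<^sub>2"
  shows "N\<^sub>1 \<le> N\<^sub>2"
proof (rule ccontr)
  assume "\<not> N\<^sub>1 \<le> N\<^sub>2"
  have opt1: "2 * real N\<^sub>1 + \<gamma>\<^sub>1 * S N\<^sub>1 \<le> 2 * real N\<^sub>2 + \<gamma>\<^sub>1 * S N\<^sub>2"
    and opt2: "2 * real N\<^sub>2 + \<gamma>\<^sub>2 * S N\<^sub>2 \<le> 2 * real N\<^sub>1 + \<gamma>\<^sub>2 * S N\<^sub>1"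
    using assms(1,2) by (simp_all add: is_arg_min_linorder)
  have "\<gamma>\<^sub>1 * S N\<^sub>1 < \<gamma>\<^sub>1 * S N\<^sub>2"
    using opt1 \<open>\<not> N\<^sub>1 \<le> N\<^sub>2\<close> by linarith
  then have "S N\<^sub>1 < S N\<^sub>2"
    using \<open>0 < \<gamma>\<^sub>1\<close> by simp
  then have "(\<gamma>\<^sub>2 - \<gamma>\<^sub>1) * S N\<^sub>1 < (\<gamma>\<^sub>2 - \<gamma>\<^sub>1) * S N\<^sub>2"
    using \<open>\<gamma>\<^sub>1 < \<gamma>\<^sub>2\<close> by simp
  then show False
    using opt1 opt2 by (simp add: left_diff_distrib)
qed

lemma penalized_minimizer_exceeds:
  fixes S :: "nat \<Rightarrow> real"
  assumes decr: "\<And>M N. 1 \<le> M \<Longrightarrow> M < N \<Longrightarrow> S N < S M" and "B \<ge> 1"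
  obtains \<gamma> where "\<gamma> > 0"
    and "\<And>N. is_arg_min (\<lambda>N. 2 * real N + \<gamma> * S N) (\<lambda>N. N \<ge> 1) N \<Longrightarrow> B < N"
proof
  define g where "g = S B - S (Suc B)"
  have "g > 0"
    using decr[of B "Suc B"] \<open>B \<ge> 1\<close> by (simp add: g_def)
  \<comment> \<open>With this weight the guaranteed saving \<open>\<gamma> * g\<close> equals the whole linear part at \<open>B + 1\<close>.\<close>
  define \<gamma> where "\<gamma> = 2 * real (Suc B) / g"
  show "\<gamma> > 0"
    using \<open>g > 0\<close> by (simp add: \<gamma>_def)
  fix N assume min: "is_arg_min (\<lambda>N. 2 * real N + \<gamma> * S N) (\<lambda>N. N \<ge> 1) N"
  show "B < N"
  proof (rule ccontr)
    assume "\<not> B < N"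
    have "1 \<le> N" and opt: "2 * real N + \<gamma> * S N \<le> 2 * real (Suc B) + \<gamma> * S (Suc B)"
      using min unfolding is_arg_min_linorder by auto
    have "S B \<le> S N"
      using decr[of N B] \<open>1 \<le> N\<close> \<open>\<not> B < N\<close> by (cases "N = B") auto
    then have "\<gamma> * g \<le> \<gamma> * (S N - S (Suc B))"
      using \<open>\<gamma> > 0\<close> by (simp add: g_def)
    moreover have "\<gamma> * g = 2 * real (Suc B)"
      using \<open>g > 0\<close> by (simp add: \<gamma>_def)
    ultimately show False
      using opt \<open>1 \<le> N\<close> by (simp add: right_diff_distrib)
  qed
qed

lemma gauss_eigenvalue_strict_mono:
  assumes "\<delta> > 0" and "m < n"
  shows "gauss_eigenvalue \<delta> m < gauss_eigenvalue \<delta> n"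
proof -
  have "(real m * \<delta>)\<^sup>2 < (real n * \<delta>)\<^sup>2"
    using assms by (intro power_strict_mono) auto
  then show ?thesis
    using assms unfolding gauss_eigenvalue_def by (intro mult_strict_left_mono) auto
qed

lemma gauss_eigenvalue_pos:
  assumes "\<delta> > 0" and "n \<ge> 1"
  shows "gauss_eigenvalue \<delta> n > 0"
  using gauss_eigenvalue_strict_mono[of \<delta> 0 n] assms by (simp add: gauss_eigenvalue_def)

lemma inverse_gauss_eigenvalue_antimono:
  assumes "\<delta> > 0" and "1 \<le> m" and "m \<le> n"
  shows "1 / gauss_eigenvalue \<delta> n \<le> 1 / gauss_eigenvalue \<delta> m"
  using gauss_eigenvalue_strict_mono[of \<delta> m n] gauss_eigenvalue_pos[of \<delta> m] assms
  by (cases "m = n") (auto intro!: divide_left_mono)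

lemma energy_term_nonneg:
  assumes "\<delta> > 0" and "N \<ge> 1"
  shows "0 \<le> energy_term \<delta> \<omega> N (Suc k)"
proof -
  have "0 < gauss_eigenvalue \<delta> (Suc k * N)"
    using assms by (intro gauss_eigenvalue_pos) auto
  then show ?thesis
    unfolding energy_term_def by (intro mult_nonneg_nonneg) auto
qed

lemma energy_term_antimono:
  assumes "\<delta> > 0" and "1 \<le> M" and "M \<le> N"
  shows "energy_term \<delta> \<omega> N (Suc k) \<le> energy_term \<delta> \<omega> M (Suc k)"
  unfolding energy_term_def
  using assms by (intro mult_right_mono inverse_gauss_eigenvalue_antimono mult_le_mono) auto

text \<open>The eigenvalues stay above \<open>gauss_eigenvalue \<delta> N > 0\<close>, so the series is dominated by a
  multiple of the sum of inverse squares.\<close>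

lemma summable_energy_term:
  assumes "\<delta> > 0" and "N \<ge> 1"
  shows "summable (\<lambda>k. energy_term \<delta> \<omega> N (Suc k))"
proof (rule summable_comparison_test', rule summable_mult)
  show "summable (\<lambda>k. inverse (real (Suc k) ^ 2))"
    using inverse_power_summable[of 2, where 'a = real] by (subst summable_Suc_iff) simp
  fix k :: nat
  have "energy_term \<delta> \<omega> N (Suc k)
      \<le> 1 / gauss_eigenvalue \<delta> N * inverse (real (Suc k) ^ 2)"
    unfolding energy_term_def
  proof (rule mult_mono)
    show "1 / gauss_eigenvalue \<delta> (Suc k * N) \<le> 1 / gauss_eigenvalue \<delta> N"
      using assms by (intro inverse_gauss_eigenvalue_antimono) auto
    have "(sin x)\<^sup>2 \<le> 1" for x :: real
      by (simp add: abs_square_le_1)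
    then show "(sin (real (Suc k) * pi * \<omega>) / real (Suc k))\<^sup>2 \<le> inverse (real (Suc k) ^ 2)"
      unfolding power_divide inverse_eq_divide by (intro divide_right_mono) auto
  qed (use gauss_eigenvalue_pos[OF assms] in auto)
  then show "norm (energy_term \<delta> \<omega> N (Suc k))
      \<le> 1 / gauss_eigenvalue \<delta> N * inverse (real (Suc k) ^ 2)"
    using energy_term_nonneg[OF assms] by simp
qed

lemma suminf_energy_term_strict_decreasing:
  assumes "\<delta> > 0" and "0 < \<omega>" and "\<omega> < 1" and "1 \<le> M" and "M < N"
  shows "(\<Sum>k. energy_term \<delta> \<omega> N (Suc k)) < (\<Sum>k. energy_term \<delta> \<omega> M (Suc k))"
proof -
  let ?d = "\<lambda>k. energy_term \<delta> \<omega> M (Suc k) - energy_term \<delta> \<omega> N (Suc k)"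
  have sM: "summable (\<lambda>k. energy_term \<delta> \<omega> M (Suc k))"
    and sN: "summable (\<lambda>k. energy_term \<delta> \<omega> N (Suc k))"
    using assms by (auto intro: summable_energy_term)
  have "sin (pi * \<omega>) > 0"
    using assms by (intro sin_gt_zero) auto
  moreover have "1 / gauss_eigenvalue \<delta> N < 1 / gauss_eigenvalue \<delta> M"
    using assms gauss_eigenvalue_pos[of \<delta> M] gauss_eigenvalue_strict_mono[of \<delta> M N]
    by (intro divide_strict_left_mono) auto
  ultimately have "0 < ?d 0"
    unfolding energy_term_def diff_gt_0_iff_gt
    by (simp only: mult_1 of_nat_1 div_by_1 One_nat_def[symmetric])
      (intro mult_strict_right_mono zero_less_power)
  moreover have "0 \<le> ?d k" for k
    using assms energy_term_antimono[of \<delta> M N] by simp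
  ultimately have "0 < (\<Sum>k. ?d k)"
    using suminf_pos_iff[OF summable_diff[OF sM sN]] by blast
  then show ?thesis
    by (simp add: suminf_diff[OF sM sN, symmetric])
qed

theorem corollary3p1:
  fixes \<delta> \<omega> :: real
  assumes "0 < \<delta>" and "\<delta> < pi" and "0 < \<omega>" and "\<omega> < 1 / 2"
  shows "(\<forall>N\<ge>1. summable (\<lambda>k. energy_term \<delta> \<omega> N (Suc k)))
       \<and> (\<forall>\<gamma>>0. is_energy_minimizer \<delta> \<omega> \<gamma> (N_star \<delta> \<omega> \<gamma>)
             \<and> (\<forall>N. is_energy_minimizer \<delta> \<omega> \<gamma> N \<longrightarrow> N \<le> N_star \<delta> \<omega> \<gamma>))
       \<and> mono_on {0<..} (N_star \<delta> \<omega>)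
       \<and> \<not> bdd_above (N_star \<delta> \<omega> ` {0<..})"
proof -
  define S where "S = (\<lambda>N. 2 / pi * (\<Sum>k. energy_term \<delta> \<omega> N (Suc k)))"
  have nonneg: "0 \<le> S N" if "N \<ge> 1" for N
    unfolding S_def
    using that assms
    by (intro mult_nonneg_nonneg suminf_nonneg summable_energy_term energy_term_nonneg) auto
  have decr: "S N < S M" if "1 \<le> M" "M < N" for M N
    unfolding S_def using that assms
    by (intro mult_strict_left_mono suminf_energy_term_strict_decreasing) auto
  have energy_eq: "energy \<delta> \<omega> \<gamma> = (\<lambda>N. 2 * real N + \<gamma> * S N)" for \<gamma>
    by (rule ext) (simp add: energy_def S_def)
  have minimizer_iff: "is_energy_minimizer \<delta> \<omega> \<gamma>
      = is_arg_min (\<lambda>N. 2 * real N + \<gamma> * S N) (\<lambda>N. N \<ge> 1)" for \<gamma>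
    by (rule ext) (simp only: is_energy_minimizer_def energy_eq)
  have star: "is_energy_minimizer \<delta> \<omega> \<gamma> (N_star \<delta> \<omega> \<gamma>)"
      "is_energy_minimizer \<delta> \<omega> \<gamma> N \<Longrightarrow> N \<le> N_star \<delta> \<omega> \<gamma>" if "\<gamma> > 0" for \<gamma> N
    unfolding N_star_def minimizer_iff
    using penalized_Greatest_minimizer[of S, OF nonneg that] by auto
  have "mono_on {0<..} (N_star \<delta> \<omega>)"
  proof (rule mono_onI)
    fix \<gamma>\<^sub>1 \<gamma>\<^sub>2 :: real
    assume "\<gamma>\<^sub>1 \<in> {0<..}" "\<gamma>\<^sub>2 \<in> {0<..}" "\<gamma>\<^sub>1 \<le> \<gamma>\<^sub>2"
    then show "N_star \<delta> \<omega> \<gamma>\<^sub>1 \<le> N_star \<delta> \<omega> \<gamma>\<^sub>2"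
      using penalized_minimizer_mono[of \<gamma>\<^sub>1 S "N_star \<delta> \<omega> \<gamma>\<^sub>1" \<gamma>\<^sub>2 "N_star \<delta> \<omega> \<gamma>\<^sub>2"] star(1)
      by (cases "\<gamma>\<^sub>1 = \<gamma>\<^sub>2") (auto simp: minimizer_iff)
  qed
  moreover have "\<not> bdd_above (N_star \<delta> \<omega> ` {0<..})"
  proof
    assume "bdd_above (N_star \<delta> \<omega> ` {0<..})"
    then obtain B where B: "N_star \<delta> \<omega> \<gamma> \<le> B" if "\<gamma> > 0" for \<gamma>
      by (auto simp: bdd_above_def)
    obtain \<gamma> where "\<gamma> > 0"
      and "\<And>N. is_energy_minimizer \<delta> \<omega> \<gamma> N \<Longrightarrow> Suc B < N"
      using penalized_minimizer_exceeds[of S "Suc B"] decr unfolding minimizer_iff by auto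
    then show False
      using B star(1) by fastforce
  qed
  moreover have "summable (\<lambda>k. energy_term \<delta> \<omega> N (Suc k))" if "N \<ge> 1" for N
    using assms(1) that by (rule summable_energy_term)
  ultimately show ?thesis
    using star by auto
qed

end
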